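(* Let $(\mathbf S,\mathcal A,\to)$ be a PTS. For every process $s\in\mathbf S$ and every $k\in\mathbb N$, $s\models\varphi_s^k$. Moreover, if $s$ is finite, then $s\models\varphi_s$.
   Context: A PTS is a triple $(\mathbf S,\mathcal A,\to)$ with $\mathbf S$ a countable set of processes, $\mathcal A$ a countable set of actions and $\to\subseteq\mathbf S\times\mathcal A\times\Delta(\mathbf S)$, where $\Delta(\mathbf S)$ is the set of probability distributions on $\mathbf S$ with finite support. Write $s\xrightarrow{a}\pi$ for $(s,a,\pi)\in\to$; $\mathrm{init}(s)=\{a\mid \exists\pi.\ s\xrightarrow a\pi\}$; $\mathrm{der}(s,a)=\{\pi\mid s\xrightarrow a\pi\}$; $\mathrm{supp}(\pi)=\{t\mid\pi(t)>0\}$. The depth of $s$ is $0$ if $\mathrm{init}(s)=\emptyset$ and otherwise $1+\sup\{\mathrm{depth}(t)\mid a\in\mathrm{init}(s),\pi\in\mathrm{der}(s,a),t\in\mathrm{supp}(\pi)\}$. A process is finite if $\mathrm{der}(s,a)$ is finite for every $a$ (image-finite) and its depth is finite. Logic $\mathcal L$: state formulae $\varphi::=\top\mid\neg\varphi\mid\bigwedge_{j\in J}\varphi_j\mid\langle a\rangle\psi$ ($J\neq\emptyset$ at most countable, $a\in\mathcal A$); distribution formulae $\psi::=\bigoplus_{i\in I}r_i\varphi_i$ ($I$ finite nonempty, $r_i\in(0,1]$, $\sum_i r_i=1$). Write $\langle a\rangle\varphi$ for $\langle a\rangle(1\varphi)$. Satisfaction: $s\models\top$ always; $s\models\neg\varphi$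 iff not $s\models\varphi$; $s\models\bigwedge_j\varphi_j$ iff $s\models\varphi_j$ for all $j$; $s\models\langle a\rangle\psi$ iff $s\xrightarrow a\pi$ for some $\pi$ with $\pi\models\psi$; $\pi\models\bigoplus_{i\in I}r_i\varphi_i$ iff $\pi=\sum_{i\in I}r_i\pi_i$ for some $\pi_i\in\Delta(\mathbf S)$ such that $t\models\varphi_i$ for all $i$ and all $t\in\mathrm{supp}(\pi_i)$. Mimicking formulae: $\varphi_s^0=\top$ and, for $k\ge1$, $\varphi_s^k=\bigwedge_{(s,a,\pi)\in\to}\langle a\rangle\psi_\pi^{k-1}\wedge\bigwedge_{b\notin\mathrm{init}(s)}\neg\langle b\rangle\top$ (a single conjunction over all these conjuncts), where $\psi_\pi^k=\bigoplus_{t\in\mathrm{supp}(\pi)}\pi(t)\varphi_t^k$. For finite $s$, the mimicking formula is $\varphi_s=\varphi_s^{\mathrm{depth}(s)+1}$. *)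

theory Defs
  imports "HOL-Probability.Probability_Mass_Function" "HOL-Library.Extended_Nat"
begin

definition fin_distr :: "'s set \<Rightarrow> 's pmf set" where
  "fin_distr S = {\<pi>. finite (set_pmf \<pi>) \<and> set_pmf \<pi> \<subseteq> S}"

definition pts :: "'s set \<Rightarrow> 'a set \<Rightarrow> ('s \<times> 'a \<times> 's pmf) set \<Rightarrow> bool" where
  "pts S A T \<longleftrightarrow> countable S \<and> countable A \<and> T \<subseteq> S \<times> A \<times> fin_distr S"

definition init :: "('s \<times> 'a \<times> 's pmf) set \<Rightarrow> 's \<Rightarrow> 'a set" where
  "init T s = {a. \<exists>\<pi>. (s, a, \<pi>) \<in> T}"

definition der :: "('s \<times> 'a \<times> 's pmf) set \<Rightarrow> 's \<Rightarrow> 'a \<Rightarrow> 's pmf set" where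
  "der T s a = {\<pi>. (s, a, \<pi>) \<in> T}"

definition depth_step :: "('s \<times> 'a \<times> 's pmf) set \<Rightarrow> ('s \<Rightarrow> enat) \<Rightarrow> 's \<Rightarrow> enat" where
  "depth_step T d s =
     (if init T s = {} then 0
      else 1 + Sup {d t |t a \<pi>. a \<in> init T s \<and> \<pi> \<in> der T s a \<and> t \<in> set_pmf \<pi>})"

text \<open>
  The recursive equation for the depth has exactly one solution with values in
  \<^typ>\<open>enat\<close> (see \<open>depth_eq\<close> and \<open>depth_unique\<close>), so the choice of the least fixed
  point is immaterial.
\<close>

definition depth :: "('s \<times> 'a \<times> 's pmf) set \<Rightarrow> 's \<Rightarrow> enat" where
  "depth T = lfp (depth_step T)"

lemma mono_depth_step:
  fixes T :: "('s \<times> 'a \<times> 's pmf) set"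
  shows "mono (depth_step T)"
proof (rule monoI)
  fix d d' :: "'s \<Rightarrow> enat"
  assume le: "d \<le> d'"
  show "depth_step T d \<le> depth_step T d'"
  proof (rule le_funI)
    fix s
    have "Sup {d t |t a \<pi>. a \<in> init T s \<and> \<pi> \<in> der T s a \<and> t \<in> set_pmf \<pi>}
       \<le> Sup {d' t |t a \<pi>. a \<in> init T s \<and> \<pi> \<in> der T s a \<and> t \<in> set_pmf \<pi>}"
      by (rule Sup_mono) (use le in \<open>auto simp: le_fun_def\<close>)
    then show "depth_step T d s \<le> depth_step T d' s"
      by (simp add: depth_step_def add_left_mono)
  qed
qed

lemma depth_eq:
  "depth T s =
     (if init T s = {} then 0
      else 1 + Sup {depth T t |t a \<pi>. a \<in> init T s \<and> \<pi> \<in> der T s a \<and> t \<in> set_pmf \<pi>})"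
  using fun_cong[OF lfp_unfold[OF mono_depth_step[of T]], of s]
  by (simp add: depth_def[symmetric] depth_step_def)

lemma depth_unique:
  fixes T :: "('s \<times> 'a \<times> 's pmf) set"
  assumes "\<And>s. d s = depth_step T d s"
  shows "d = depth T"
proof -
  have le: "f s \<le> g s"
    if f: "\<And>s. f s = depth_step T f s" and g: "\<And>s. g s = depth_step T g s" for f g s
  proof -
    have "enat n \<le> g s" if "enat n \<le> f s" for n
      using that
    proof (induction n arbitrary: s)
      case 0
      show ?case by (simp add: zero_enat_def[symmetric])
    next
      case (Suc n)
      define X where "X h = {h t |t a \<pi>. a \<in> init T s \<and> \<pi> \<in> der T s a \<and> t \<in> set_pmf \<pi>}"
        for h :: "'s \<Rightarrow> enat"
      have ne: "init T s \<noteq> {}"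
        using Suc.prems f[of s] by (auto simp: depth_step_def zero_enat_def)
      have fs: "f s = 1 + Sup (X f)" and gs: "g s = 1 + Sup (X g)"
        using ne f[of s] g[of s] by (simp_all add: depth_step_def X_def)
      have "enat n \<le> Sup (X f)"
        using Suc.prems unfolding fs by (cases "Sup (X f)") (auto simp: one_enat_def)
      have "enat n \<le> Sup (X g)"
      proof (cases n)
        case 0
        then show ?thesis by (simp add: zero_enat_def[symmetric])
      next
        case (Suc m)
        then have "enat m < Sup (X f)"
          using \<open>enat n \<le> Sup (X f)\<close> by (cases "Sup (X f)") auto
        then obtain x where "x \<in> X f" "enat m < x"
          by (auto simp: less_Sup_iff)
        then obtain t a \<pi> where t: "a \<in> init T s" "\<pi> \<in> der T s a" "t \<in> set_pmf \<pi>"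
          and "enat m < f t"
          by (auto simp: X_def)
        then have "enat n \<le> f t"
          using \<open>n = Suc m\<close> by (cases "f t") auto
        then have "enat n \<le> g t"
          by (rule Suc.IH)
        also have "g t \<le> Sup (X g)"
          by (rule Sup_upper) (use t in \<open>auto simp: X_def\<close>)
        finally show ?thesis .
      qed
      then show ?case
        unfolding gs by (cases "Sup (X g)") (auto simp: one_enat_def)
    qed
    note step = this
    show ?thesis
    proof (cases "f s")
      case (enat n)
      then show ?thesis using step[of n] by simp
    next
      case infinity
      then have le_g: "enat n \<le> g s" for n using step[of n] by simp
      show ?thesis
      proof (cases "g s")
        case (enat m)
        then show ?thesis using le_g[of "Suc m"] by simp
      qed simp
    qed
  qed
  have "depth T s = depth_step T (depth T) s" for s
    by (subst depth_eq) (simp add: depth_step_def)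
  then show ?thesis
    using le[of d "depth T"] le[of "depth T" d] assms by (auto intro!: ext antisym)
qed

definition finite_process :: "('s \<times> 'a \<times> 's pmf) set \<Rightarrow> 's \<Rightarrow> bool" where
  "finite_process T s \<longleftrightarrow> (\<forall>a. finite (der T s a)) \<and> depth T s \<noteq> \<infinity>"

text \<open>
  Conjunctions and distribution formulae carry an index set and an indexed family;
  \<open>'i\<close> and \<open>'j\<close> are the types of the two kinds of indices. The side conditions of the
  grammar are the predicates \<open>in_logic\<close> and \<open>in_dlogic\<close> below. They are not built into
  the datatype, because a state may have uncountably many outgoing transitions (the
  probabilities are arbitrary reals), and the mimicking formula then is an uncountable
  conjunction.
\<close>

datatype ('a, 'i, 'j) sform =
    Top
  | Neg "('a, 'i, 'j) sform"
  | Conj "'i set" "'i \<Rightarrow> ('a, 'i, 'j) sform"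
  | Dia 'a "('a, 'i, 'j) dform"
and ('a, 'i, 'j) dform =
    Oplus "'j set" "'j \<Rightarrow> real" "'j \<Rightarrow> ('a, 'i, 'j) sform"

primrec in_logic :: "'a set \<Rightarrow> ('a, 'i, 'j) sform \<Rightarrow> bool"
  and in_dlogic :: "'a set \<Rightarrow> ('a, 'i, 'j) dform \<Rightarrow> bool" where
  "in_logic A Top \<longleftrightarrow> True"
| "in_logic A (Neg \<phi>) \<longleftrightarrow> in_logic A \<phi>"
| "in_logic A (Conj J \<Phi>) \<longleftrightarrow> J \<noteq> {} \<and> countable J \<and> (\<forall>j\<in>J. in_logic A (\<Phi> j))"
| "in_logic A (Dia a \<psi>) \<longleftrightarrow> a \<in> A \<and> in_dlogic A \<psi>"
| "in_dlogic A (Oplus I r \<Phi>) \<longleftrightarrow>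
     finite I \<and> I \<noteq> {} \<and> (\<forall>i\<in>I. 0 < r i \<and> r i \<le> 1) \<and> (\<Sum>i\<in>I. r i) = 1 \<and>
     (\<forall>i\<in>I. in_logic A (\<Phi> i))"

primrec sat :: "'s set \<Rightarrow> ('s \<times> 'a \<times> 's pmf) set \<Rightarrow> ('a, 'i, 'j) sform \<Rightarrow> 's \<Rightarrow> bool"
  and dsat :: "'s set \<Rightarrow> ('s \<times> 'a \<times> 's pmf) set \<Rightarrow> ('a, 'i, 'j) dform \<Rightarrow> 's pmf \<Rightarrow> bool"
where
  "sat S T Top = (\<lambda>s. True)"
| "sat S T (Neg \<phi>) = (\<lambda>s. \<not> sat S T \<phi> s)"
| "sat S T (Conj J \<Phi>) = (\<lambda>s. \<forall>j\<in>J. sat S T (\<Phi> j) s)"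
| "sat S T (Dia a \<psi>) = (\<lambda>s. \<exists>\<pi>. (s, a, \<pi>) \<in> T \<and> dsat S T \<psi> \<pi>)"
| "dsat S T (Oplus I r \<Phi>) =
     (\<lambda>\<pi>. \<exists>\<rho>. (\<forall>i\<in>I. \<rho> i \<in> fin_distr S) \<and>
               (\<forall>t. pmf \<pi> t = (\<Sum>i\<in>I. r i * pmf (\<rho> i) t)) \<and>
               (\<forall>i\<in>I. \<forall>t\<in>set_pmf (\<rho> i). sat S T (\<Phi> i) t))"

text \<open>The formula \<open>\<langle>a\<rangle>(1 \<phi>)\<close>; which index the singleton family uses is immaterial.\<close>

definition Dia_one :: "'a \<Rightarrow> ('a, 'i, 'j) sform \<Rightarrow> ('a, 'i, 'j) sform" where
  "Dia_one a \<phi> = Dia a (Oplus {undefined} (\<lambda>_. 1) (\<lambda>_. \<phi>))"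

text \<open>
  The conjuncts of the mimicking formula of \<open>s\<close> are indexed by the disjoint union of the
  outgoing transitions of \<open>s\<close> and the actions not in \<open>init T s\<close>.
\<close>

primrec mimick ::
  "'a set \<Rightarrow> ('s \<times> 'a \<times> 's pmf) set \<Rightarrow> nat \<Rightarrow> 's \<Rightarrow> ('a, ('a \<times> 's pmf) + 'a, 's) sform"
where
  "mimick A T 0 = (\<lambda>s. Top)"
| "mimick A T (Suc k) =
     (\<lambda>s. Conj ({(a, \<pi>). (s, a, \<pi>) \<in> T} <+> (A - init T s))
            (\<lambda>j. case j of
                Inl (a, \<pi>) \<Rightarrow> Dia a (Oplus (set_pmf \<pi>) (pmf \<pi>) (mimick A T k))
              | Inr b \<Rightarrow> Neg (Dia_one b Top)))"

definition mimicking ::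
  "'a set \<Rightarrow> ('s \<times> 'a \<times> 's pmf) set \<Rightarrow> 's \<Rightarrow> ('a, ('a \<times> 's pmf) + 'a, 's) sform"
where
  "mimicking A T s = mimick A T (the_enat (depth T s) + 1) s"

lemma in_logic_mimick:
  assumes pts: "pts S A T" and "A \<noteq> {}"
    and count: "\<And>s. s \<in> S \<Longrightarrow> countable {(a, \<pi>). (s, a, \<pi>) \<in> T}"
    and "s \<in> S"
  shows "in_logic A (mimick A T k s)"
  using \<open>s \<in> S\<close>
proof (induction k arbitrary: s)
  case 0
  show ?case by simp
next
  case (Suc k)
  let ?J = "{(a, \<pi>). (s, a, \<pi>) \<in> T} <+> (A - init T s)"
  have "?J \<noteq> {}"
    using \<open>A \<noteq> {}\<close> by (auto simp: init_def Plus_def)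
  moreover have "countable ?J"
    using count[OF Suc.prems] pts by (auto simp: Plus_def pts_def)
  moreover have "in_dlogic A (Oplus (set_pmf \<pi>) (pmf \<pi>) (mimick A T k)) \<and> a \<in> A"
    if "(s, a, \<pi>) \<in> T" for a \<pi>
  proof -
    have "finite (set_pmf \<pi>)" "set_pmf \<pi> \<subseteq> S" "a \<in> A"
      using pts that by (auto simp: pts_def fin_distr_def)
    then show ?thesis
      using Suc.IH by (auto simp: pmf_positive pmf_le_1 sum_pmf_eq_1 set_pmf_not_empty)
  qed
  ultimately show ?case
    by (auto simp: Dia_one_def)
qed

end

theory Submission imports Defs begin

text \<open>
  A finitely supported distribution \<open>\<pi>\<close> decomposes as the convex combination
  \<open>\<Sum>t \<in> supp \<pi>. \<pi>(t) \<delta>\<^sub>t\<close> of point masses, so it satisfies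
  \<open>\<Oplus>t \<in> supp \<pi>. \<pi>(t) \<phi>\<^sub>t\<close> as soon as every \<open>t\<close> in its support satisfies \<open>\<phi>\<^sub>t\<close>.
\<close>

lemma dsat_Oplus_self:
  assumes "\<pi> \<in> fin_distr S" and "\<And>t. t \<in> set_pmf \<pi> \<Longrightarrow> sat S T (\<Phi> t) t"
  shows "dsat S T (Oplus (set_pmf \<pi>) (pmf \<pi>) \<Phi>) \<pi>"
proof -
  have fin: "finite (set_pmf \<pi>)" and sub: "set_pmf \<pi> \<subseteq> S"
    using assms(1) by (auto simp: fin_distr_def)
  have "(\<Sum>i\<in>set_pmf \<pi>. pmf \<pi> i * pmf (return_pmf i) t) = pmf \<pi> t" for t
  proof -
    have "(\<Sum>i\<in>set_pmf \<pi>. pmf \<pi> i * pmf (return_pmf i) t)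
        = (\<Sum>i\<in>set_pmf \<pi>. if i = t then pmf \<pi> i else 0)"
      by (intro sum.cong) (auto simp: indicator_def)
    also have "\<dots> = pmf \<pi> t"
      \<comment> \<open>If \<open>t\<close> lies outside the support, both sides are 0.\<close>
      using fin by (simp add: sum.delta set_pmf_iff)
    finally show ?thesis .
  qed
  then show ?thesis
    unfolding dsat.simps using sub assms(2)
    by (intro exI[of _ return_pmf] conjI) (auto simp: fin_distr_def simp del: pmf_return)
qed

text \<open>Each transition of \<open>s\<close> is the witness for its own diamond; supports stay in
  \<open>S\<close>, so the induction hypothesis for \<open>k\<close> covers the targets.\<close>

lemma sat_mimick:
  assumes "pts S A T" and "s \<in> S"
  shows "sat S T (mimick A T k s) s"
  using \<open>s \<in> S\<close>
proof (induction k arbitrary: s)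
  case 0
  show ?case by simp
next
  case (Suc k)
  have "dsat S T (Oplus (set_pmf \<pi>) (pmf \<pi>) (mimick A T k)) \<pi>" if "(s, a, \<pi>) \<in> T" for a \<pi>
  proof (rule dsat_Oplus_self)
    show "\<pi> \<in> fin_distr S"
      using assms(1) that by (auto simp: pts_def)
    then show "sat S T (mimick A T k t) t" if "t \<in> set_pmf \<pi>" for t
      using that by (intro Suc.IH) (auto simp: fin_distr_def)
  qed
  then show ?case
    \<comment> \<open>The negated conjuncts hold since \<open>s\<close> has no
      \<open>b\<close>-transition for \<open>b\<close> outside \<open>init T s\<close>.\<close>
    by (fastforce simp: Dia_one_def init_def simp del: dsat.simps)
qed

theorem theorem1:
  fixes S :: "'s set" and A :: "'a set" and T :: "('s \<times> 'a \<times> 's pmf) set"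
  assumes "pts S A T"
  shows "(\<forall>s\<in>S. \<forall>k::nat. sat S T (mimick A T k s) s) \<and>
         (\<forall>s\<in>S. finite_process T s \<longrightarrow> sat S T (mimicking A T s) s)"
  \<comment> \<open>The second part is the instance \<open>k = the_enat (depth T s) + 1\<close>,
    kept folded.\<close>
  using sat_mimick[OF assms] by (simp add: mimicking_def del: mimick.simps)

end
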